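(* Let $M$ be an o-minimal structure and let $(A,\tau)$ be an infinite topological space definable in $M$. Then $(A,\tau)$ has weight at most $|A|$.
   Context: O-minimality is understood in the sense of van den Dries' book "Tame Topology and O-minimal Structures": $M$ is an expansion of a dense linear order $(M,<)$ without endpoints such that every subset of $M$ definable with parameters is a finite union of points and open intervals with endpoints in $M\cup\{-\infty,+\infty\}$. "Definable" means definable in $M$, possibly with parameters from $M$. A topological space $(A,\tau)$ is definable in $M$ when $A\subseteq M^n$ (for some $n$) is a definable set and there exists a definable basis for the topology $\tau$, i.e. a basis of the form $\{\varphi(A;b) : b\in B\}$ for some formula $\varphi(x;y)$ with $|x|=n$ and some definable set $B\subseteq M^{|y|}$, where $\varphi(A;b)=\{a\in A : M\models\varphi(a;b)\}$. The weight of a topological space is the minimum cardinality of a basis for its topology. *)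

theory Defs
  imports "HOL-Analysis.Abstract_Topology"
begin

unbundle cardinal_syntax

section \<open>First-order formulas over an expansion of a linear order\<close>

text \<open>The symbols of the language are the elements of the (possibly empty) sets \<open>fun_syms\<close> and
  \<open>rel_syms\<close>, together with a binary symbol \<open>Lt\<close> for the order, so that every
  structure below expands the order of the type \<open>'m\<close>, whose universe is the universe of the
  structure. Interpretations are only ever applied to lists whose length is the arity of the
  symbol, see \<open>wf_trm\<close> and \<open>wf_fm\<close>.\<close>

datatype 'f trm = Var nat | Fn 'f "'f trm list"

datatype ('f, 'r) fm =
    Eq "'f trm" "'f trm"
  | Lt "'f trm" "'f trm"
  | Rel 'r "'f trm list"
  | Neg "('f, 'r) fm"
  | And "('f, 'r) fm" "('f, 'r) fm"
  | Exi nat "('f, 'r) fm"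

record ('f, 'r, 'm) struct =
  fun_syms :: "'f set"
  rel_syms :: "'r set"
  fun_arity :: "'f \<Rightarrow> nat"
  rel_arity :: "'r \<Rightarrow> nat"
  fun_interp :: "'f \<Rightarrow> 'm list \<Rightarrow> 'm"
  rel_interp :: "'r \<Rightarrow> 'm list \<Rightarrow> bool"

fun wf_trm :: "('f, 'r, 'm) struct \<Rightarrow> 'f trm \<Rightarrow> bool" where
  "wf_trm M (Var i) \<longleftrightarrow> True"
| "wf_trm M (Fn f ts) \<longleftrightarrow>
     f \<in> fun_syms M \<and> length ts = fun_arity M f \<and> (\<forall>t \<in> set ts. wf_trm M t)"

primrec wf_fm :: "('f, 'r, 'm) struct \<Rightarrow> ('f, 'r) fm \<Rightarrow> bool" where
  "wf_fm M (Eq s t) \<longleftrightarrow> wf_trm M s \<and> wf_trm M t"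
| "wf_fm M (Lt s t) \<longleftrightarrow> wf_trm M s \<and> wf_trm M t"
| "wf_fm M (Rel r ts) \<longleftrightarrow>
     r \<in> rel_syms M \<and> length ts = rel_arity M r \<and> (\<forall>t \<in> set ts. wf_trm M t)"
| "wf_fm M (Neg p) \<longleftrightarrow> wf_fm M p"
| "wf_fm M (And p q) \<longleftrightarrow> wf_fm M p \<and> wf_fm M q"
| "wf_fm M (Exi i p) \<longleftrightarrow> wf_fm M p"

fun fv_trm :: "'f trm \<Rightarrow> nat set" where
  "fv_trm (Var i) = {i}"
| "fv_trm (Fn f ts) = (\<Union>t \<in> set ts. fv_trm t)"

primrec fv :: "('f, 'r) fm \<Rightarrow> nat set" where
  "fv (Eq s t) = fv_trm s \<union> fv_trm t"
| "fv (Lt s t) = fv_trm s \<union> fv_trm t"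
| "fv (Rel r ts) = (\<Union>t \<in> set ts. fv_trm t)"
| "fv (Neg p) = fv p"
| "fv (And p q) = fv p \<union> fv q"
| "fv (Exi i p) = fv p - {i}"

primrec eval_trm :: "('f, 'r, 'm) struct \<Rightarrow> (nat \<Rightarrow> 'm) \<Rightarrow> 'f trm \<Rightarrow> 'm" where
  "eval_trm M e (Var i) = e i"
| "eval_trm M e (Fn f ts) = fun_interp M f (map (eval_trm M e) ts)"

primrec sat :: "('f, 'r, 'm::linorder) struct \<Rightarrow> (nat \<Rightarrow> 'm) \<Rightarrow> ('f, 'r) fm \<Rightarrow> bool" where
  "sat M e (Eq s t) \<longleftrightarrow> eval_trm M e s = eval_trm M e t"
| "sat M e (Lt s t) \<longleftrightarrow> eval_trm M e s < eval_trm M e t"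
| "sat M e (Rel r ts) \<longleftrightarrow> rel_interp M r (map (eval_trm M e) ts)"
| "sat M e (Neg p) \<longleftrightarrow> \<not> sat M e p"
| "sat M e (And p q) \<longleftrightarrow> sat M e p \<and> sat M e q"
| "sat M e (Exi i p) \<longleftrightarrow> (\<exists>a. sat M (e(i := a)) p)"

section \<open>Definable sets and o-minimality\<close>

text \<open>The \<open>n\<close>-th power of the universe is the set of lists of length \<open>n\<close>. A formula
  \<open>p(x; y)\<close> with \<open>n\<close> variables \<open>x\<close> and \<open>m\<close> variables \<open>y\<close> has the
  variables \<open>x\<close> numbered \<open>0, ..., n - 1\<close> and the variables \<open>y\<close> numbered
  \<open>n, ..., n + m - 1\<close>.\<close>

definition is_formula :: "('f, 'r, 'm) struct \<Rightarrow> nat \<Rightarrow> nat \<Rightarrow> ('f, 'r) fm \<Rightarrow> bool" where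
  "is_formula M n m p \<longleftrightarrow> wf_fm M p \<and> fv p \<subseteq> {..<n + m}"

text \<open>The value of \<open>(!)\<close> past the end of the list is irrelevant, by the condition on free
  variables in \<open>is_formula\<close>.\<close>

definition holds :: "('f, 'r, 'm::linorder) struct \<Rightarrow> ('f, 'r) fm \<Rightarrow> 'm list \<Rightarrow> 'm list \<Rightarrow> bool" where
  "holds M p a b \<longleftrightarrow> sat M ((!) (a @ b)) p"

text \<open>Definability with parameters \<open>c\<close>.\<close>

definition definable :: "('f, 'r, 'm::linorder) struct \<Rightarrow> nat \<Rightarrow> 'm list set \<Rightarrow> bool" where
  "definable M n D \<longleftrightarrow>
     (\<exists>p m c. is_formula M n m p \<and> length c = m \<and> D = {a. length a = n \<and> holds M p a c})"

definition open_interval :: "'m::linorder set \<Rightarrow> bool" where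
  "open_interval I \<longleftrightarrow>
     (\<exists>a b. I = {a<..<b}) \<or> (\<exists>b. I = {..<b}) \<or> (\<exists>a. I = {a<..}) \<or> I = UNIV"

definition o_minimal :: "('f, 'r, 'm::unbounded_dense_linorder) struct \<Rightarrow> bool" where
  "o_minimal M \<longleftrightarrow>
     (\<forall>S. definable M 1 {[x] |x. x \<in> S} \<longrightarrow>
        (\<exists>F. finite F \<and> (\<forall>I \<in> F. (\<exists>a. I = {a}) \<or> open_interval I) \<and> S = \<Union> F))"

section \<open>Definable topological spaces and weight\<close>

definition topology_basis :: "'a topology \<Rightarrow> 'a set set \<Rightarrow> bool" where
  "topology_basis X \<B> \<longleftrightarrow>
     (\<forall>V \<in> \<B>. openin X V) \<and> (\<forall>U x. openin X U \<and> x \<in> U \<longrightarrow> (\<exists>V \<in> \<B>. x \<in> V \<and> V \<subseteq> U))"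

definition definable_topological_space ::
    "('f, 'r, 'm::linorder) struct \<Rightarrow> nat \<Rightarrow> 'm list topology \<Rightarrow> bool" where
  "definable_topological_space M n X \<longleftrightarrow>
     definable M n (topspace X) \<and>
     (\<exists>p m B. is_formula M n m p \<and> definable M m B \<and>
        topology_basis X {{a \<in> topspace X. holds M p a b} |b. b \<in> B})"

text \<open>As a cardinal, the weight is the cardinality of a basis that is minimal with respect to
  cardinality; \<open>weight_attained\<close> and
  \<open>weight_le\<close> say that it is the minimum over all bases.\<close>

definition weight :: "'a topology \<Rightarrow> 'a set rel" where
  "weight X = |SOME \<B>. topology_basis X \<B> \<and> (\<forall>\<C>. topology_basis X \<C> \<longrightarrow> |\<B>| \<le>o |\<C>| )|"

lemma minimal_topology_basis_exists:
  "\<exists>\<B>. topology_basis X \<B> \<and> (\<forall>\<C>. topology_basis X \<C> \<longrightarrow> |\<B>| \<le>o |\<C>| )"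
proof -
  let ?R = "card_of ` {\<B>. topology_basis X \<B>}"
  have "topology_basis X {U. openin X U}"
    unfolding topology_basis_def by blast
  then have "?R \<noteq> {}" by blast
  moreover have "\<forall>r \<in> ?R. Card_order r"
    by (auto intro: card_of_Card_order)
  ultimately have "\<exists>r \<in> ?R. \<forall>s \<in> ?R. r \<le>o s"
    by (rule exists_minim_Card_order)
  then show ?thesis by simp
qed

lemma weight_attained: "\<exists>\<B>. topology_basis X \<B> \<and> weight X = |\<B>|"
  using someI_ex[OF minimal_topology_basis_exists[of X]] unfolding weight_def by (intro exI conjI) auto

lemma weight_le: "topology_basis X \<B> \<Longrightarrow> weight X \<le>o |\<B>|"
  using someI_ex[OF minimal_topology_basis_exists[of X]] unfolding weight_def by simp

end

theory Submission
  imports Defs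
begin

text \<open>For a definable \<open>P(x; y)\<close> with parameters, the number of traces
  \<open>P(A; b)\<close> is at most \<open>|A|\<close>, by induction on the length of \<open>y\<close>. To
  eliminate the last entry \<open>b\<close> of \<open>y\<close>, let \<open>E\<close> be the set of all boundary
  points of the sections \<open>{z. P(a; ..., z)}\<close> with \<open>a \<in> A\<close>. If \<open>b\<close>
  lies in \<open>E\<close>, it is determined by some \<open>a \<in> A\<close> and its position among the
  finitely many boundary points for \<open>a\<close>; otherwise the trace depends only on the position
  of \<open>b\<close> relative to the finite boundary of \<open>E\<close>. Either way the trace is that of
  a definable predicate without the variable \<open>b\<close>, with \<open>a\<close> as an additional
  parameter, and only \<open>|A|\<close> many predicates are needed.\<close>

section \<open>Definable predicates on assignments\<close>

lemma finite_fv_trm: "finite (fv_trm t)"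
  by (induction t) auto

lemma finite_fv: "finite (fv p)"
  by (induction p) (auto simp: finite_fv_trm)

lemma eval_trm_cong: "(\<And>i. i \<in> fv_trm t \<Longrightarrow> e i = e' i) \<Longrightarrow> eval_trm M e t = eval_trm M e' t"
proof (induction t)
  case (Fn f ts)
  have "eval_trm M e t = eval_trm M e' t" if "t \<in> set ts" for t
    using that Fn.prems by (intro Fn.IH) auto
  then have "map (eval_trm M e) ts = map (eval_trm M e') ts"
    by simp
  then show ?case by (simp only: eval_trm.simps)
qed simp

lemma sat_cong: "(\<And>i. i \<in> fv p \<Longrightarrow> e i = e' i) \<Longrightarrow> sat M e p \<longleftrightarrow> sat M e' p"
proof (induction p arbitrary: e e')
  case (Eq s t)
  then have "eval_trm M e s = eval_trm M e' s" "eval_trm M e t = eval_trm M e' t"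
    using eval_trm_cong[of s e e' M] eval_trm_cong[of t e e' M] by auto
  then show ?case by simp
next
  case (Lt s t)
  then have "eval_trm M e s = eval_trm M e' s" "eval_trm M e t = eval_trm M e' t"
    using eval_trm_cong[of s e e' M] eval_trm_cong[of t e e' M] by auto
  then show ?case by simp
next
  case (Rel r ts)
  then have "eval_trm M e t = eval_trm M e' t" if "t \<in> set ts" for t
    using that by (intro eval_trm_cong) auto
  then have "map (eval_trm M e) ts = map (eval_trm M e') ts"
    by simp
  then show ?case by (simp only: sat.simps)
next
  case (Neg p)
  have "sat M e p \<longleftrightarrow> sat M e' p" by (rule Neg.IH) (simp add: Neg.prems)
  then show ?case by simp
next
  case (And p q)
  have "sat M e p \<longleftrightarrow> sat M e' p" by (rule And.IH) (simp add: And.prems)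
  moreover have "sat M e q \<longleftrightarrow> sat M e' q" by (rule And.IH) (simp add: And.prems)
  ultimately show ?case by simp
next
  case (Exi i p)
  then have "sat M (e(i := a)) p \<longleftrightarrow> sat M (e'(i := a)) p" for a
    by (intro Exi.IH) auto
  then show ?case by simp
qed

primrec ren_trm :: "(nat \<Rightarrow> nat) \<Rightarrow> 'f trm \<Rightarrow> 'f trm" where
  "ren_trm s (Var i) = Var (s i)"
| "ren_trm s (Fn f ts) = Fn f (map (ren_trm s) ts)"

lemma wf_ren_trm: "wf_trm M t \<Longrightarrow> wf_trm M (ren_trm s t)"
  by (induction t) auto

lemma eval_ren_trm: "eval_trm M e (ren_trm s t) = eval_trm M (e \<circ> s) t"
proof (induction t)
  case (Fn f ts)
  then have "map (eval_trm M e) (map (ren_trm s) ts) = map (eval_trm M (e \<circ> s)) ts"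
    by (simp add: comp_def)
  then show ?case by (simp only: eval_trm.simps ren_trm.simps)
qed simp

lemma renaming_exists:
  "wf_fm M p \<Longrightarrow> \<exists>q. wf_fm M q \<and> (\<forall>e. sat M e q \<longleftrightarrow> sat M (e \<circ> s) p)"
proof (induction p arbitrary: s)
  case (Eq t u)
  then show ?case
    by (intro exI[of _ "Eq (ren_trm s t) (ren_trm s u)"]) (simp add: wf_ren_trm eval_ren_trm comp_def)
next
  case (Lt t u)
  then show ?case
    by (intro exI[of _ "Lt (ren_trm s t) (ren_trm s u)"]) (simp add: wf_ren_trm eval_ren_trm comp_def)
next
  case (Rel r ts)
  have "map (eval_trm M e) (map (ren_trm s) ts) = map (eval_trm M (e \<circ> s)) ts" for e
    by (simp add: eval_ren_trm)
  then have "sat M e (Rel r (map (ren_trm s) ts)) \<longleftrightarrow> sat M (e \<circ> s) (Rel r ts)" for e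
    by (simp only: sat.simps)
  with Rel show ?case
    by (intro exI[of _ "Rel r (map (ren_trm s) ts)"]) (auto simp: wf_ren_trm comp_def simp del: sat.simps)
next
  case (Neg p)
  then obtain q where "wf_fm M q" "\<forall>e. sat M e q \<longleftrightarrow> sat M (e \<circ> s) p"
    unfolding wf_fm.simps by blast
  then show ?case by (intro exI[of _ "Neg q"]) (simp add: comp_def)
next
  case (And p1 p2)
  then obtain q1 q2 where "wf_fm M q1" "\<forall>e. sat M e q1 \<longleftrightarrow> sat M (e \<circ> s) p1"
    "wf_fm M q2" "\<forall>e. sat M e q2 \<longleftrightarrow> sat M (e \<circ> s) p2"
    unfolding wf_fm.simps by blast
  then show ?case by (intro exI[of _ "And q1 q2"]) (simp add: comp_def)
next
  case (Exi i p)
  obtain k where k: "k \<notin> s ` fv p"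
    using ex_new_if_finite[of "s ` fv p"] finite_fv[of p] by auto
  from Exi obtain q where q: "wf_fm M q" "\<forall>e. sat M e q \<longleftrightarrow> sat M (e \<circ> s(i := k)) p"
    unfolding wf_fm.simps by blast
  have "sat M (e(k := a)) q \<longleftrightarrow> sat M ((e \<circ> s)(i := a)) p" for e a
    unfolding q(2)[rule_format] using k by (intro sat_cong) (auto simp: image_iff)
  with q show ?case by (intro exI[of _ "Exi k q"]) (simp add: comp_def)
qed

text \<open>Even positions carry the variables, odd positions the parameters.\<close>

definition interleave :: "(nat \<Rightarrow> 'm) \<Rightarrow> (nat \<Rightarrow> 'm) \<Rightarrow> nat \<Rightarrow> 'm" where
  "interleave e c i = (if even i then e (i div 2) else c (i div 2))"

text \<open>A semantic notion of definability with parameters, free of arities. As \<open>p\<close>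
  has finitely many free variables, only finitely many entries of the sequence \<open>c\<close>
  matter.\<close>

definition definable_pred :: "('f, 'r, 'm::linorder) struct \<Rightarrow> ((nat \<Rightarrow> 'm) \<Rightarrow> bool) \<Rightarrow> bool" where
  "definable_pred M P \<longleftrightarrow> (\<exists>p c. wf_fm M p \<and> (\<forall>e. P e \<longleftrightarrow> sat M (interleave e c) p))"

text \<open>The substitutions that a mere renaming of positions can realise: variables stay
  variables, constants become parameters.\<close>

definition coord :: "((nat \<Rightarrow> 'm) \<Rightarrow> 'm) \<Rightarrow> bool" where
  "coord t \<longleftrightarrow> (\<exists>j. t = (\<lambda>e. e j)) \<or> (\<exists>x. t = (\<lambda>e. x))"

lemma coord_var [simp, intro]: "coord (\<lambda>e. e j)"
  unfolding coord_def by blast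

lemma coord_const [simp, intro]: "coord (\<lambda>e. x)"
  unfolding coord_def by blast

lemma coord_if [simp, intro]: "coord t \<Longrightarrow> coord u \<Longrightarrow> coord (\<lambda>e. if b then t e else u e)"
  by (cases b) auto

lemma definable_pred_sat:
  assumes "wf_fm M p" "\<And>i. coord (\<lambda>e. h e i)"
  shows "definable_pred M (\<lambda>e. sat M (h e) p)"
proof -
  \<comment> \<open>Where a coordinate of \<open>h\<close> is constant, its value can be read off at
    any assignment, here \<open>undefined\<close>. These values serve as parameters, and
    \<open>h e\<close> becomes a renaming of \<open>interleave e c\<close>.\<close>
  define c where "c = (\<lambda>i. h undefined i)"
  have "\<exists>k. \<forall>e. h e i = interleave e c k" for i
    using assms(2)[of i] unfolding coord_def
  proof (elim disjE exE)
    fix j assume "(\<lambda>e. h e i) = (\<lambda>e. e j)"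
    then show ?thesis by (intro exI[of _ "2 * j"]) (auto simp: interleave_def fun_eq_iff)
  next
    fix x assume "(\<lambda>e. h e i) = (\<lambda>e. x)"
    then show ?thesis by (intro exI[of _ "2 * i + 1"]) (auto simp: interleave_def fun_eq_iff c_def)
  qed
  then obtain s where s: "\<And>i e. h e i = interleave e c (s i)" by metis
  obtain q where "wf_fm M q" "\<forall>e. sat M e q \<longleftrightarrow> sat M (e \<circ> s) p"
    using renaming_exists[OF assms(1)] by blast
  moreover have "h e = interleave e c \<circ> s" for e
    by (simp add: s fun_eq_iff)
  ultimately show ?thesis
    unfolding definable_pred_def by (intro exI[of _ q] exI[of _ c]) simp
qed

lemma coord_interleave:
  assumes "\<And>i. coord (\<lambda>e. h e i)"
  shows "coord (\<lambda>e. interleave (h e) c i)"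
  using assms by (simp add: interleave_def)

lemma definable_pred_subst:
  assumes "definable_pred M P" "\<And>i. coord (\<lambda>e. h e i)"
  shows "definable_pred M (\<lambda>e. P (h e))"
proof -
  obtain p c where p: "wf_fm M p" "\<forall>e. P e \<longleftrightarrow> sat M (interleave e c) p"
    using assms(1) unfolding definable_pred_def by blast
  show ?thesis
    using definable_pred_sat[OF p(1) coord_interleave[OF assms(2), where c = c]] p(2) by simp
qed

section \<open>Closure of definable predicates under connectives and quantifiers\<close>

lemma definable_pred_not: "definable_pred M P \<Longrightarrow> definable_pred M (\<lambda>e. \<not> P e)"
  unfolding definable_pred_def by (metis sat.simps(4) wf_fm.simps(4))

lemma definable_pred_and:
  assumes "definable_pred M P" "definable_pred M Q"
  shows "definable_pred M (\<lambda>e. P e \<and> Q e)"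
proof -
  obtain p c where p: "wf_fm M p" "\<forall>e. P e \<longleftrightarrow> sat M (interleave e c) p"
    using assms(1) unfolding definable_pred_def by blast
  obtain q d where q: "wf_fm M q" "\<forall>e. Q e \<longleftrightarrow> sat M (interleave e d) q"
    using assms(2) unfolding definable_pred_def by blast
  \<comment> \<open>The parameter sequences are merged into \<open>interleave c d\<close>. Parameter
    \<open>k\<close> sits at \<open>i = 2k + 1\<close>; in the merged sequence \<open>c k\<close>
    has number \<open>2k\<close>, hence position \<open>4k + 1 = 2i - 1\<close>, and
    \<open>d k\<close> has number \<open>2k + 1\<close>, hence position
    \<open>4k + 3 = 2i + 1\<close>.\<close>
  let ?s = "\<lambda>i. if even i then i else 2 * i - 1"
  let ?t = "\<lambda>i. if even i then i else 2 * i + 1"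
  obtain p' where p': "wf_fm M p'" "\<forall>e. sat M e p' \<longleftrightarrow> sat M (e \<circ> ?s) p"
    using renaming_exists[OF p(1)] by blast
  obtain q' where q': "wf_fm M q'" "\<forall>e. sat M e q' \<longleftrightarrow> sat M (e \<circ> ?t) q"
    using renaming_exists[OF q(1)] by blast
  have "(interleave e (interleave c d) \<circ> ?s) i = interleave e c i \<and>
      (interleave e (interleave c d) \<circ> ?t) i = interleave e d i" for e i
  proof (cases "even i")
    case False
    then obtain k where "i = 2 * k + 1" by (rule oddE)
    then have "?s i = 2 * (2 * k) + 1" "?t i = 2 * (2 * k + 1) + 1" "i div 2 = k"
      by simp_all
    then show ?thesis
      using False unfolding interleave_def comp_def by (simp only:) simp
  qed (simp add: interleave_def)
  then have "interleave e (interleave c d) \<circ> ?s = interleave e c"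
    "interleave e (interleave c d) \<circ> ?t = interleave e d" for e
    by (intro ext; blast)+
  then have "P e \<and> Q e \<longleftrightarrow> sat M (interleave e (interleave c d)) (And p' q')" for e
    by (simp only: sat.simps p(2) q(2) p'(2) q'(2))
  moreover have "wf_fm M (And p' q')"
    using p'(1) q'(1) by simp
  ultimately show ?thesis
    unfolding definable_pred_def by blast
qed

lemma definable_pred_or:
  assumes "definable_pred M P" "definable_pred M Q"
  shows "definable_pred M (\<lambda>e. P e \<or> Q e)"
proof -
  have "definable_pred M (\<lambda>e. \<not> (\<not> P e \<and> \<not> Q e))"
    by (intro definable_pred_not definable_pred_and assms)
  then show ?thesis by (simp only: de_Morgan_conj not_not)
qed

lemma definable_pred_imp:
  assumes "definable_pred M P" "definable_pred M Q"
  shows "definable_pred M (\<lambda>e. P e \<longrightarrow> Q e)"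
  unfolding imp_conv_disj by (intro definable_pred_not definable_pred_or assms)

lemma definable_pred_iff:
  assumes "definable_pred M P" "definable_pred M Q"
  shows "definable_pred M (\<lambda>e. P e \<longleftrightarrow> Q e)"
  unfolding iff_conv_conj_imp by (intro definable_pred_imp definable_pred_and assms)

text \<open>Quantifiers are handled as with de Bruijn indices: the bound variable becomes variable 0
  and all other variables are shifted.\<close>

lemma definable_pred_ex:
  assumes "definable_pred M (\<lambda>e. R (e \<circ> Suc) (e 0))"
  shows "definable_pred M (\<lambda>e. \<exists>x. R e x)"
proof -
  obtain p c where p: "wf_fm M p" "\<And>e. R (e \<circ> Suc) (e 0) \<longleftrightarrow> sat M (interleave e c) p"
    using assms unfolding definable_pred_def by blast
  have "sat M ((interleave e c)(0 := a)) p \<longleftrightarrow> R (e \<circ> Suc) a" for e a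
  proof -
    have "(interleave e c)(0 := a) = interleave (e(0 := a)) c"
      by (auto simp: interleave_def fun_eq_iff elim: evenE)
    moreover have "e(0 := a) \<circ> Suc = e \<circ> Suc"
      by (simp add: fun_eq_iff)
    ultimately show ?thesis
      using p(2)[of "e(0 := a)"] by simp
  qed
  then have "definable_pred M (\<lambda>e. \<exists>x. R (e \<circ> Suc) x)"
    unfolding definable_pred_def using p(1) by (intro exI[of _ "Exi 0 p"] exI[of _ c]) simp
  \<comment> \<open>Substituting \<open>e (i - 1)\<close> undoes the shift: composed with
    \<open>Suc\<close> it gives back \<open>e\<close>.\<close>
  from definable_pred_subst[OF this, of "\<lambda>e i. e (i - 1)"] show ?thesis
    by (simp add: o_def)
qed

lemma definable_pred_all:
  assumes "definable_pred M (\<lambda>e. R (e \<circ> Suc) (e 0))"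
  shows "definable_pred M (\<lambda>e. \<forall>x. R e x)"
proof -
  have "definable_pred M (\<lambda>e. \<not> (\<exists>x. \<not> R e x))"
    by (intro definable_pred_not definable_pred_ex assms)
  then show ?thesis by simp
qed

lemma definable_pred_less:
  assumes "coord t" "coord u"
  shows "definable_pred M (\<lambda>e. t e < u e)"
  using definable_pred_sat[of M "fm.Lt (Var 0) (Var 1)" "\<lambda>e i. if i = 0 then t e else u e"] assms
  by simp

lemmas definable_pred_intros = definable_pred_not definable_pred_and definable_pred_or
  definable_pred_imp definable_pred_iff definable_pred_ex definable_pred_all definable_pred_less

text \<open>A definable family of subsets of the line, indexed by assignments. The point of the line
  is variable 0, which matches the quantifier rules.\<close>

definition definable_rel ::
    "('f, 'r, 'm::linorder) struct \<Rightarrow> ((nat \<Rightarrow> 'm) \<Rightarrow> 'm \<Rightarrow> bool) \<Rightarrow> bool" where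
  "definable_rel M R \<longleftrightarrow> definable_pred M (\<lambda>e. R (e \<circ> Suc) (e 0))"

lemma definable_rel_subst:
  assumes "definable_rel M R" "\<And>i. coord (\<lambda>e. h e i)" "coord t"
  shows "definable_pred M (\<lambda>e. R (h e) (t e))"
proof -
  let ?h = "\<lambda>e i. if i = 0 then t e else h e (i - 1)"
  have "definable_pred M (\<lambda>e. R (?h e \<circ> Suc) (?h e 0))"
    by (rule definable_pred_subst[OF assms(1)[unfolded definable_rel_def], of ?h])
      (intro coord_if assms(2,3))
  moreover have "?h e \<circ> Suc = h e" "?h e 0 = t e" for e
    by (simp_all add: fun_eq_iff)
  ultimately show ?thesis by (simp only:)
qed

text \<open>Induction on \<open>n\<close> peels off the head of the list: it is bound by the
  innermost quantifier, hence is variable 0, and the tail is left to the induction hypothesis. The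
  outer assignment starts at position \<open>n\<close>.\<close>

lemma definable_pred_ex_tuple:
  fixes M :: "('f, 'r, 'm::linorder) struct"
  assumes "definable_pred M (\<lambda>e. R (map e [0..<n]) (\<lambda>i. e (i + n)))"
  shows "definable_pred M (\<lambda>e. \<exists>a. length a = n \<and> R a e)"
  using assms
proof (induction n arbitrary: R)
  case 0
  then show ?case by simp
next
  case (Suc n)
  have "map e [0..<Suc n] = e 0 # map (e \<circ> Suc) [0..<n]" for e :: "nat \<Rightarrow> 'm"
    by (simp add: map_upt_Suc del: upt_Suc)
  with Suc.prems have
    "definable_pred M (\<lambda>e. R (e 0 # map (e \<circ> Suc) [0..<n]) (\<lambda>i. (e \<circ> Suc) (i + n)))"
    by (simp del: upt_Suc)
  then have "definable_pred M (\<lambda>e. \<exists>x. R (x # map e [0..<n]) (\<lambda>i. e (i + n)))"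
    by (rule definable_pred_ex)
  from Suc.IH[OF this] have "definable_pred M (\<lambda>e. \<exists>a. length a = n \<and> (\<exists>x. R (x # a) e))" .
  moreover have "(\<exists>a. length a = n \<and> (\<exists>x. R (x # a) e)) \<longleftrightarrow> (\<exists>a. length a = Suc n \<and> R a e)" for e
    by (auto simp: length_Suc_conv)
  ultimately show ?case by (simp only:)
qed

lemma definable_pred_bex:
  assumes "A \<subseteq> {a. length a = n}" "definable_pred M (\<lambda>e. map e [0..<n] \<in> A)"
    and "definable_pred M (\<lambda>e. R (map e [0..<n]) (\<lambda>i. e (i + n)))"
  shows "definable_pred M (\<lambda>e. \<exists>a \<in> A. R a e)"
proof -
  have "(\<exists>a. length a = n \<and> a \<in> A \<and> R a e) \<longleftrightarrow> (\<exists>a \<in> A. R a e)" for e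
    using assms(1) by auto
  moreover have "definable_pred M (\<lambda>e. \<exists>a. length a = n \<and> a \<in> A \<and> R a e)"
    by (intro definable_pred_ex_tuple definable_pred_and assms(2,3))
  ultimately show ?thesis by (simp only:)
qed

section \<open>Boundaries of definable subsets of the line\<close>

text \<open>In an order without endpoints this is the topological boundary for the order topology,
  spelled out in first-order form so that it is definable uniformly in families.\<close>

definition bd :: "'m::linorder set \<Rightarrow> 'm set" where
  "bd S = {y. \<forall>l u. l < y \<and> y < u \<longrightarrow> (\<exists>x. l < x \<and> x < u \<and> (x \<in> S \<longleftrightarrow> y \<notin> S))}"

text \<open>The form in which o-minimality is used. It has to be recorded separately from
  \<open>bd\<close>: in an order with gaps, a set can change along an interval that contains none of
  its boundary points.\<close>

definition constant_off :: "'m::linorder set \<Rightarrow> 'm set \<Rightarrow> bool" where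
  "constant_off F S \<longleftrightarrow> (\<forall>x y. x < y \<longrightarrow> {x..y} \<inter> F = {} \<longrightarrow> (x \<in> S \<longleftrightarrow> y \<in> S))"

lemma constant_off_Union:
  assumes "\<And>I. I \<in> \<I> \<Longrightarrow> constant_off (f I) I"
  shows "constant_off (\<Union>(f ` \<I>)) (\<Union>\<I>)"
  unfolding constant_off_def
proof (intro allI impI)
  fix x y assume "x < y" "{x..y} \<inter> \<Union>(f ` \<I>) = {}"
  then have "x \<in> I \<longleftrightarrow> y \<in> I" if "I \<in> \<I>" for I
    using assms[OF that] that unfolding constant_off_def by blast
  then show "x \<in> \<Union>\<I> \<longleftrightarrow> y \<in> \<Union>\<I>" by blast
qed

lemma constant_off_open_interval:
  assumes "(\<exists>a. I = {a}) \<or> open_interval I"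
  shows "\<exists>F. finite F \<and> constant_off F I"
proof -
  have 1: "constant_off {a} {a}" for a :: 'a
    unfolding constant_off_def by auto
  have 2: "constant_off {a, b} {a<..<b}" for a b :: 'a
    unfolding constant_off_def by (auto simp: not_less)
  have 3: "constant_off {b} {..<b}" for b :: 'a
    unfolding constant_off_def by auto
  have 4: "constant_off {a} {a<..}" for a :: 'a
    unfolding constant_off_def by auto
  have 5: "constant_off {} (UNIV :: 'a set)"
    unfolding constant_off_def by auto
  from assms show ?thesis
    unfolding open_interval_def using 1 2 3 4 5
    by (metis finite.emptyI finite.insertI)
qed

text \<open>Around a non-boundary point \<open>f\<close> the set is constant on some open interval.
  By density this interval contains points strictly between \<open>x\<close> and \<open>f\<close>
  and between \<open>f\<close> and \<open>y\<close>; they link \<open>x\<close> and \<open>y\<close>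
  to \<open>f\<close> along intervals that avoid \<open>F\<close>.\<close>

lemma constant_off_Diff_non_bd:
  fixes S :: "'m::unbounded_dense_linorder set"
  assumes "finite F" "constant_off F S" "f \<notin> bd S"
  shows "constant_off (F - {f}) S"
  unfolding constant_off_def
proof (intro allI impI)
  fix x y assume xy: "x < y" "{x..y} \<inter> (F - {f}) = {}"
  show "x \<in> S \<longleftrightarrow> y \<in> S"
  proof (cases "x \<le> f \<and> f \<le> y")
    case False
    then have "f \<notin> {x..y}" by simp
    with xy(2) have "{x..y} \<inter> F = {}" by blast
    with xy(1) assms(2) show ?thesis unfolding constant_off_def by blast
  next
    case True
    have "\<exists>l u. l < f \<and> f < u \<and> \<not> (\<exists>z. l < z \<and> z < u \<and> (z \<in> S \<longleftrightarrow> f \<notin> S))"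
      using assms(3) unfolding bd_def by blast
    then obtain l u where lu: "l < f" "f < u" "\<And>z. l < z \<Longrightarrow> z < u \<Longrightarrow> z \<in> S \<longleftrightarrow> f \<in> S"
      by blast
    have "x \<in> S \<longleftrightarrow> f \<in> S"
    proof (cases "x = f")
      case False
      with True have "x < f" using le_neq_trans by blast
      with lu(1) have "max l x < f" by simp
      then obtain z where z: "max l x < z" "z < f" using dense by blast
      have "z \<le> y" using z(2) True less_imp_le order_trans by blast
      then have "{x..z} \<subseteq> {x..y}" "f \<notin> {x..z}" using z(2)[folded not_le] by simp_all
      with xy(2) have "{x..z} \<inter> F = {}" by blast
      moreover have "x < z" "l < z" "z < u" using z lu(2) by simp_all
      ultimately show ?thesis using assms(2) lu(3) unfolding constant_off_def by blast
    qed simp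
    moreover have "y \<in> S \<longleftrightarrow> f \<in> S"
    proof (cases "y = f")
      case False
      with True have "f < y" using le_neq_trans by blast
      with lu(2) have "f < min u y" by simp
      then obtain z where z: "f < z" "z < min u y" using dense by blast
      have "x \<le> z" using z(1) True less_imp_le order_trans by blast
      then have "{z..y} \<subseteq> {x..y}" "f \<notin> {z..y}" using z(1)[folded not_le] by simp_all
      with xy(2) have "{z..y} \<inter> F = {}" by blast
      moreover have "z < y" "l < z" "z < u" using z lu(1) by simp_all
      ultimately show ?thesis using assms(2) lu(3) unfolding constant_off_def by blast
    qed simp
    ultimately show ?thesis by blast
  qed
qed

text \<open>The boundary is the least possible exceptional set. Non-boundary points can be deleted
  from \<open>F\<close> one by one, and every boundary point lies in \<open>F\<close>, since a point
  outside \<open>F\<close> has a neighbourhood free of \<open>F\<close>.\<close>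

lemma constant_off_bd:
  fixes S :: "'m::unbounded_dense_linorder set"
  assumes "finite F" "constant_off F S"
  shows "finite (bd S)" "constant_off (bd S) S"
proof -
  have remove: "constant_off (F - G) S" if "finite G" "G \<inter> bd S = {}" for G
    using that
  proof (induction G)
    case empty
    then show ?case using assms by simp
  next
    case (insert g G)
    then have "constant_off (F - G - {g}) S"
      using assms(1) by (intro constant_off_Diff_non_bd) auto
    moreover have "F - insert g G = F - G - {g}" by blast
    ultimately show ?case by simp
  qed
  have "constant_off (F - (F - bd S)) S"
    by (rule remove) (use assms(1) in auto)
  moreover have "F - (F - bd S) = F \<inter> bd S" by blast
  ultimately have *: "constant_off (F \<inter> bd S) S" by simp
  have "bd S \<subseteq> F"
  proof
    fix y assume y: "y \<in> bd S"
    show "y \<in> F"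
    proof (rule ccontr)
      assume "y \<notin> F"
      \<comment> \<open>\<open>l\<close> and \<open>u\<close> are the neighbours of \<open>y\<close>
        in \<open>F\<close>, or arbitrary points on the respective side if there are none. The open
        interval between them misses \<open>F\<close>.\<close>
      obtain l where l: "l < y" "\<And>f. f \<in> F \<Longrightarrow> f < y \<Longrightarrow> f \<le> l"
      proof (cases "{f \<in> F. f < y} = {}")
        case True
        then show ?thesis using that lt_ex[of y] by blast
      next
        case False
        have fin: "finite {f \<in> F. f < y}" using assms(1) by simp
        show ?thesis
          using Max_in[OF fin False] Max_ge[OF fin] by (intro that[of "Max {f \<in> F. f < y}"]) simp_all
      qed
      obtain u where u: "y < u" "\<And>f. f \<in> F \<Longrightarrow> y < f \<Longrightarrow> u \<le> f"
      proof (cases "{f \<in> F. y < f} = {}")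
        case True
        then show ?thesis using that gt_ex[of y] by blast
      next
        case False
        have fin: "finite {f \<in> F. y < f}" using assms(1) by simp
        show ?thesis
          using Min_in[OF fin False] Min_le[OF fin] by (intro that[of "Min {f \<in> F. y < f}"]) simp_all
      qed
      obtain x where x: "l < x" "x < u" "x \<in> S \<longleftrightarrow> y \<notin> S"
        using y l(1) u(1) unfolding bd_def by blast
      have *: "l < min x y" "max x y < u"
        using x l(1) u(1) by simp_all
      have "f \<notin> {min x y..max x y}" if "f \<in> F" for f
      proof -
        have "f \<le> l \<or> u \<le> f"
          using l(2)[OF that] u(2)[OF that] that \<open>y \<notin> F\<close> by (cases f y rule: linorder_cases) auto
        then have "f < min x y \<or> max x y < f"
          using * le_less_trans less_le_trans by blast
        then show ?thesis by (simp only: atLeastAtMost_iff not_le de_Morgan_conj)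
      qed
      then have "{min x y..max x y} \<inter> F = {}" by blast
      moreover have "x \<noteq> y" using x(3) by blast
      ultimately have "x \<in> S \<longleftrightarrow> y \<in> S"
        using assms(2) unfolding constant_off_def by (cases x y rule: linorder_cases) auto
      with x(3) show False by blast
    qed
  qed
  with * assms(1) show "finite (bd S)" "constant_off (bd S) S"
    by (auto intro: finite_subset simp: Int_absorb1)
qed

lemma definable_rel_tame:
  fixes M :: "('f, 'r, 'm::unbounded_dense_linorder) struct"
  assumes "o_minimal M" "definable_rel M R"
  shows "finite (bd {y. R e y})" "constant_off (bd {y. R e y}) {y. R e y}"
proof -
  obtain p c where p: "wf_fm M p" "\<And>e. R (e \<circ> Suc) (e 0) \<longleftrightarrow> sat M (interleave e c) p"
    using assms(2) unfolding definable_rel_def definable_pred_def by blast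
  \<comment> \<open>The shift of \<open>e\<close> that makes room for \<open>y\<close> as variable
    0; the entry at 0 is overwritten.\<close>
  define g where "g = (\<lambda>i. e (i - 1))"
  obtain m where m: "\<And>i. i \<in> fv p \<Longrightarrow> i \<le> m"
    using finite_nat_set_iff_bounded_le[THEN iffD1, OF finite_fv[of p]] by blast
  \<comment> \<open>Position 0 carries \<open>y\<close>. All other positions up to the bound
    \<open>m\<close> on the free variables, whether variables or parameters, form the parameter
    tuple.\<close>
  define d where "d = map (interleave g c) [1..<1 + m]"
  have "R e y \<longleftrightarrow> holds M p [y] d" for y
  proof -
    have "g(0 := y) \<circ> Suc = e" "(g(0 := y)) 0 = y"
      unfolding g_def by (simp_all add: fun_eq_iff)
    then have "R e y \<longleftrightarrow> sat M (interleave (g(0 := y)) c) p"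
      using p(2)[of "g(0 := y)"] by simp
    also have "\<dots> \<longleftrightarrow> sat M ((!) ([y] @ d)) p"
    proof (rule sat_cong)
      fix i assume "i \<in> fv p"
      then have i: "i \<le> m" by (rule m)
      show "interleave (g(0 := y)) c i = ([y] @ d) ! i"
      proof (cases i)
        case 0
        then show ?thesis by (simp add: interleave_def)
      next
        case (Suc j)
        with i have "([y] @ d) ! i = interleave g c i"
          unfolding d_def by (simp del: upt_Suc)
        moreover have "i div 2 \<noteq> 0" if "even i"
          using that Suc by presburger
        ultimately show ?thesis by (cases "even i") (simp_all add: interleave_def)
      qed
    qed
    finally show ?thesis unfolding holds_def .
  qed
  then have "{[x] |x. x \<in> {y. R e y}} = {a. length a = 1 \<and> holds M p a d}"
    by (auto simp: length_Suc_conv simp del: upt_Suc)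
  moreover have "is_formula M 1 m p"
    unfolding is_formula_def using p(1) m by (auto simp: less_Suc_eq_le)
  moreover have "length d = m"
    unfolding d_def by simp
  ultimately have "definable M 1 {[x] |x. x \<in> {y. R e y}}"
    unfolding definable_def by blast
  then have "\<exists>\<I>. finite \<I> \<and> (\<forall>I \<in> \<I>. (\<exists>a. I = {a}) \<or> open_interval I) \<and> {y. R e y} = \<Union>\<I>"
    using assms(1) unfolding o_minimal_def by blast
  then obtain \<I> where I: "finite \<I>"
    "\<And>I. I \<in> \<I> \<Longrightarrow> (\<exists>a. I = {a}) \<or> open_interval I" "{y. R e y} = \<Union>\<I>"
    by blast
  have "\<forall>I \<in> \<I>. \<exists>F. finite F \<and> constant_off F I"
    using I(2) constant_off_open_interval by blast
  then obtain f where f: "\<forall>I \<in> \<I>. finite (f I) \<and> constant_off (f I) I"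
    by (rule bchoice[THEN exE])
  then have "finite (\<Union>(f ` \<I>))" "constant_off (\<Union>(f ` \<I>)) (\<Union>\<I>)"
    using I(1) by (auto intro: constant_off_Union)
  from constant_off_bd[OF this]
  show "finite (bd {y. R e y})" "constant_off (bd {y. R e y}) {y. R e y}"
    unfolding I(3) by blast+
qed

section \<open>Uniform definability of boundaries and of the cells they cut out\<close>

lemma definable_rel_bd:
  assumes "definable_rel M R"
  shows "definable_rel M (\<lambda>e y. y \<in> bd {z. R e z})"
  unfolding definable_rel_def bd_def mem_Collect_eq
  by (intro definable_pred_intros definable_rel_subst[OF assms]) (simp_all add: o_def)

text \<open>For finite \<open>G\<close>: exactly \<open>j\<close> elements of \<open>G\<close> lie
  below \<open>z\<close>. The recursion through the predecessor \<open>g\<close> of \<open>z\<close>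
  in \<open>G\<close> makes this first-order for each fixed \<open>j\<close>, which a cardinality is
  not on its face.\<close>

primrec number_below :: "'m::linorder set \<Rightarrow> nat \<Rightarrow> 'm \<Rightarrow> bool" where
  "number_below G 0 z \<longleftrightarrow> \<not> (\<exists>g. g \<in> G \<and> g < z)"
| "number_below G (Suc j) z \<longleftrightarrow>
     (\<exists>g. g \<in> G \<and> g < z \<and> number_below G j g \<and> \<not> (\<exists>h. h \<in> G \<and> g < h \<and> h < z))"

lemma number_below_iff:
  assumes "finite G"
  shows "number_below G j z \<longleftrightarrow> card {g \<in> G. g < z} = j"
proof (induction j arbitrary: z)
  case 0
  then show ?case using assms by auto
next
  case (Suc j)
  have *: "card {h \<in> G. h < z} = Suc (card {h \<in> G. h < g})"
    if g: "g \<in> G" "g < z" "\<not> (\<exists>h. h \<in> G \<and> g < h \<and> h < z)" for g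
  proof -
    have "h < z \<longleftrightarrow> h = g \<or> h < g" if "h \<in> G" for h
      using g(2,3) that less_trans linorder_neqE by metis
    then have "{h \<in> G. h < z} = insert g {h \<in> G. h < g}"
      using g(1) by blast
    then show ?thesis using assms by simp
  qed
  show ?case
  proof
    assume "number_below G (Suc j) z"
    then obtain g where g: "g \<in> G" "g < z" "number_below G j g" "\<not> (\<exists>h. h \<in> G \<and> g < h \<and> h < z)"
      unfolding number_below.simps by blast
    then show "card {g \<in> G. g < z} = Suc j"
      using *[OF g(1,2,4)] Suc.IH[of g] by simp
  next
    assume c: "card {g \<in> G. g < z} = Suc j"
    let ?B = "{g \<in> G. g < z}"
    have B: "finite ?B" "?B \<noteq> {}"
      using c card_gt_0_iff[of ?B] by simp_all
    define g where "g = Max ?B"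
    have "g \<in> ?B" "\<And>h. h \<in> ?B \<Longrightarrow> h \<le> g"
      unfolding g_def using Max_in[OF B] Max_ge[OF B(1)] by blast+
    then have g: "g \<in> G" "g < z" "\<not> (\<exists>h. h \<in> G \<and> g < h \<and> h < z)"
      using leD by blast+
    have "number_below G j g"
      using *[OF g] c Suc.IH[of g] by simp
    with g show "number_below G (Suc j) z"
      unfolding number_below.simps by blast
  qed
qed

lemma definable_rel_number_below:
  assumes "definable_rel M R"
  shows "definable_rel M (\<lambda>e y. number_below {z. R e z} j y)"
proof (induction j)
  case 0
  show ?case
    unfolding definable_rel_def number_below.simps mem_Collect_eq
    by (intro definable_pred_intros definable_rel_subst[OF assms]) (simp_all add: o_def)
next
  case (Suc j)
  show ?case
    unfolding definable_rel_def number_below.simps mem_Collect_eq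
    by (intro definable_pred_intros definable_rel_subst[OF assms] definable_rel_subst[OF Suc])
      (simp_all add: o_def)
qed

text \<open>For finite \<open>bd S\<close> the cells partition the line. With \<open>t\<close> true
  the cell is the boundary point of index \<open>j\<close>, counted from 0, or empty; with
  \<open>t\<close> false it is the set of points strictly between two consecutive boundary points,
  or beyond an extreme one.\<close>

definition cell :: "'m::linorder set \<Rightarrow> nat \<Rightarrow> bool \<Rightarrow> 'm set" where
  "cell S j t = {z. (z \<in> bd S \<longleftrightarrow> t) \<and> number_below (bd S) j z}"

lemma definable_rel_cell:
  assumes "definable_rel M R"
  shows "definable_rel M (\<lambda>e y. y \<in> cell {z. R e z} j t)"
proof -
  note bd = definable_rel_bd[OF assms]
  note nb = definable_rel_number_below[OF bd, of j, unfolded Collect_mem_eq]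
  have eq: "y \<in> cell {z. R e z} j t \<longleftrightarrow>
      (if t then y \<in> bd {z. R e z} else \<not> y \<in> bd {z. R e z}) \<and>
      number_below (bd {z. R e z}) j y" for e y
    unfolding cell_def by simp
  have "definable_rel M (\<lambda>e y. y \<in> bd {z. R e z} \<and> number_below (bd {z. R e z}) j y)"
    unfolding definable_rel_def
    by (intro definable_pred_and definable_rel_subst[OF bd] definable_rel_subst[OF nb])
      (simp_all add: o_def)
  moreover have "definable_rel M (\<lambda>e y. \<not> y \<in> bd {z. R e z} \<and> number_below (bd {z. R e z}) j y)"
    unfolding definable_rel_def
    by (intro definable_pred_and definable_pred_not definable_rel_subst[OF bd]
        definable_rel_subst[OF nb]) (simp_all add: o_def)
  ultimately show ?thesis
    unfolding eq by (cases t) (simp_all only: if_True if_False)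
qed

lemma in_cell:
  assumes "finite (bd S)"
  shows "\<exists>j. y \<in> cell S j (y \<in> bd S)"
  using number_below_iff[OF assms] unfolding cell_def by blast

text \<open>Boundary points below \<open>y\<close> are also below \<open>z\<close>, and there are
  equally many, so none lies in the interval from \<open>y\<close> up to but excluding
  \<open>z\<close>. In particular \<open>y\<close> is not one, and then neither is \<open>z\<close>,
  having the same \<open>t\<close>.\<close>

lemma cell_disjoint_bd:
  assumes "finite (bd S)" "y \<in> cell S j t" "z \<in> cell S j t" "y < z"
  shows "{y..z} \<inter> bd S = {}"
proof -
  let ?B = "\<lambda>x. {g \<in> bd S. g < x}"
  have "number_below (bd S) j y" "number_below (bd S) j z" and bd: "y \<in> bd S \<longleftrightarrow> z \<in> bd S"
    using assms(2,3) unfolding cell_def by simp_all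
  then have "card (?B y) = card (?B z)"
    unfolding number_below_iff[OF assms(1)] by simp
  moreover have "?B y \<subseteq> ?B z"
    using less_trans[OF _ assms(4)] by blast
  moreover have "finite (?B z)"
    using assms(1) by simp
  ultimately have "?B y = ?B z"
    using card_subset_eq by blast
  then have *: "g < y" if "g \<in> bd S" "g < z" for g
    using that by blast
  then have "z \<notin> bd S"
    using bd assms(4) less_irrefl by blast
  have "g \<notin> bd S" if "g \<in> {y..z}" for g
  proof
    assume g: "g \<in> bd S"
    with that \<open>z \<notin> bd S\<close> have "g \<noteq> z" "y \<le> g" "g \<le> z" by auto
    then have "g < z" using le_neq_trans by blast
    with *[OF g] \<open>y \<le> g\<close> show False using leD by blast
  qed
  then show ?thesis by blast
qed

lemma cell_bd_unique:
  assumes "finite (bd S)" "y \<in> cell S j True" "z \<in> cell S j True"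
  shows "y = z"
proof -
  have "\<not> y' < z'" if "y' \<in> cell S j True" "z' \<in> cell S j True" for y' z'
  proof
    assume "y' < z'"
    with that have "{y'..z'} \<inter> bd S = {}"
      using cell_disjoint_bd[OF assms(1)] by blast
    moreover have "y' \<in> bd S"
      using that(1) unfolding cell_def by blast
    moreover have "y' \<in> {y'..z'}"
      using \<open>y' < z'\<close> by simp
    ultimately show False by blast
  qed
  with assms(2,3) show ?thesis by (meson linorder_neqE)
qed

section \<open>Counting traces\<close>

definition upd :: "'m list \<Rightarrow> (nat \<Rightarrow> 'm) \<Rightarrow> nat \<Rightarrow> 'm" where
  "upd a e i = (if i < length a then a ! i else e i)"

lemma upd_upd: "length a = length b \<Longrightarrow> upd a (upd b e) = upd a e"
  by (simp add: upd_def fun_eq_iff)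

lemma upd_fun_upd: "length a \<le> v \<Longrightarrow> (upd a e)(v := x) = upd a (e(v := x))"
  by (simp add: upd_def fun_eq_iff)

lemma coord_upd:
  assumes "\<And>i. coord (\<lambda>e. h e i)"
  shows "coord (\<lambda>e. upd a (h e) i)"
  unfolding upd_def using assms by simp

lemma coord_upd_map:
  assumes "\<And>i. coord (\<lambda>e. h e i)"
  shows "coord (\<lambda>e. upd (map e [0..<n]) (h e) i)"
  using assms by (cases "i < n") (simp_all add: upd_def)

lemma card_of_finite_ordLeq_infinite:
  assumes "finite A" "infinite B"
  shows "|A| \<le>o |B|"
  using ordLeq_total[OF card_of_Well_order card_of_Well_order, of A B] assms card_of_ordLeq_finite
  by blast

text \<open>Freezing \<open>e\<close> to \<open>e0\<close> outside \<open>K\<close> makes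
  \<open>K\<close> the set of variables still to be eliminated: for empty \<open>K\<close> a single
  trace remains.\<close>

definition traces ::
    "'m list set \<Rightarrow> ((nat \<Rightarrow> 'm) \<Rightarrow> bool) \<Rightarrow> nat set \<Rightarrow> (nat \<Rightarrow> 'm) \<Rightarrow> 'm list set set" where
  "traces A P K e0 = {{a \<in> A. P (upd a e)} |e. \<forall>i. i \<notin> K \<longrightarrow> e i = e0 i}"

lemma card_of_traces:
  fixes M :: "('f, 'r, 'm::unbounded_dense_linorder) struct"
  assumes "o_minimal M" "A \<subseteq> {a. length a = n}" "infinite A"
    and "definable_pred M (\<lambda>e. map e [0..<n] \<in> A)"
    and "definable_pred M P"
  shows "|traces A P {n..<n + m} e0| \<le>o |A|"
  using assms(5)
proof (induction m arbitrary: P)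
  case 0
  have "e = e0" if "\<forall>i. i \<notin> {n..<n + 0} \<longrightarrow> e i = e0 i" for e
    using that by (simp add: fun_eq_iff)
  then have "traces A P {n..<n + 0} e0 \<subseteq> {{a \<in> A. P (upd a e0)}}"
    unfolding traces_def by blast
  then have "finite (traces A P {n..<n + 0} e0)"
    using finite_subset by blast
  then show ?case
    using assms(3) card_of_finite_ordLeq_infinite by blast
next
  case (Suc m)
  let ?v = "n + m" and ?K = "{n..<n + m}"
  \<comment> \<open>\<open>R\<close> singles out the last variable. \<open>E\<close> and the cell in
    \<open>Q2\<close> do not depend on the first \<open>n\<close> entries of \<open>e\<close>,
    because \<open>upd a\<close> overwrites them; so \<open>Q1\<close> and \<open>Q2\<close> replace
    the last variable by a cell that is the same for all tuples in \<open>A\<close>.\<close>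
  define R where "R e z \<longleftrightarrow> P (e(?v := z))" for e z
  define E where "E e y \<longleftrightarrow> (\<exists>a \<in> A. y \<in> bd {z. R (upd a e) z})" for e y
  define Q1 where "Q1 j t e \<longleftrightarrow> (\<exists>z. z \<in> cell {y. E e y} j t \<and> R e z)" for j t e
  define Q2 where "Q2 a j e \<longleftrightarrow> (\<exists>z. z \<in> cell {y. R (upd a e) y} j True \<and> R e z)" for a j e
  have R: "definable_rel M R"
    unfolding definable_rel_def R_def
    by (rule definable_pred_subst[OF Suc.prems]) (simp add: fun_upd_def)
  have Ra: "definable_rel M (\<lambda>e. R (upd a e))" for a
    unfolding definable_rel_def
    by (intro definable_rel_subst[OF R] coord_upd) (simp_all add: o_def)
  have E: "definable_rel M E"
    unfolding definable_rel_def E_def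
    by (intro definable_pred_bex[OF assms(2,4)] definable_rel_subst[OF definable_rel_bd[OF R]]
        coord_upd_map) (simp_all add: o_def)
  have Q1: "definable_pred M (Q1 j t)" for j t
    unfolding Q1_def
    by (intro definable_pred_ex definable_pred_and definable_rel_subst[OF R]
        definable_rel_subst[OF definable_rel_cell[OF E]]) (simp_all add: o_def)
  have Q2: "definable_pred M (Q2 a j)" for a j
    unfolding Q2_def
    by (intro definable_pred_ex definable_pred_and definable_rel_subst[OF R]
        definable_rel_subst[OF definable_rel_cell[OF Ra]]) (simp_all add: o_def)
  have "traces A P {n..<n + Suc m} e0 \<subseteq>
      (\<Union>j. \<Union>t. traces A (Q1 j t) ?K e0) \<union> (\<Union>a \<in> A. \<Union>j. traces A (Q2 a j) ?K e0)"
    (is "_ \<subseteq> ?U1 \<union> ?U2")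
  proof
    fix T assume "T \<in> traces A P {n..<n + Suc m} e0"
    then obtain e where e: "T = {a \<in> A. P (upd a e)}" "\<And>i. i \<notin> {n..<n + Suc m} \<Longrightarrow> e i = e0 i"
      unfolding traces_def by blast
    \<comment> \<open>The eliminated coordinate is reset so that \<open>e'\<close> is admissible for
      the smaller \<open>K\<close>; its true value is passed to \<open>R\<close> separately.\<close>
    define e' where "e' = e(?v := e0 ?v)"
    have e': "e' i = e0 i" if "i \<notin> ?K" for i
      using e(2)[of i] that unfolding e'_def by (cases "i = ?v") auto
    have len: "length a = n" if "a \<in> A" for a
      using assms(2) that by blast
    have P: "P (upd a e) \<longleftrightarrow> R (upd a e') (e ?v)" if "a \<in> A" for a
    proof -
      have "(upd a e')(?v := e ?v) = upd a e"
        using len[OF that] by (simp add: upd_fun_upd e'_def)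
      then show ?thesis unfolding R_def by simp
    qed
    have in_traces: "T \<in> traces A Q ?K e0"
      if "\<And>a. a \<in> A \<Longrightarrow> R (upd a e') (e ?v) \<longleftrightarrow> Q (upd a e')" for Q
    proof -
      have "T = {a \<in> A. Q (upd a e')}"
        using e(1) P that by blast
      with e' show ?thesis unfolding traces_def by blast
    qed
    show "T \<in> ?U1 \<union> ?U2"
    proof (cases "E e' (e ?v)")
      case True
      then obtain a where a: "a \<in> A" "e ?v \<in> bd {z. R (upd a e') z}"
        unfolding E_def by blast
      let ?S = "{z. R (upd a e') z}"
      have fin: "finite (bd ?S)"
        by (rule definable_rel_tame(1)[OF assms(1) Ra])
      \<comment> \<open>The cell consists of \<open>e ?v\<close> alone, so quantifying over it in
        \<open>Q2\<close> amounts to inserting this value.\<close>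
      obtain j where j: "e ?v \<in> cell ?S j True"
        using in_cell[OF fin, of "e ?v"] a(2) by (simp only: simp_thms) blast
      have "T \<in> traces A (Q2 a j) ?K e0"
      proof (rule in_traces)
        fix x assume x: "x \<in> A"
        have "upd a (upd x e') = upd a e'"
          using len[OF a(1)] len[OF x] by (simp add: upd_upd)
        then have "Q2 a j (upd x e') \<longleftrightarrow> (\<exists>z. z \<in> cell ?S j True \<and> R (upd x e') z)"
          unfolding Q2_def by (simp only:)
        then show "R (upd x e') (e ?v) \<longleftrightarrow> Q2 a j (upd x e')"
          using j cell_bd_unique[OF fin j] by blast
      qed
      with a(1) show ?thesis by blast
    next
      case False
      let ?S = "{y. E e' y}"
      \<comment> \<open>O-minimality is applied here to the union of all section boundaries over
        \<open>A\<close>. This union may be infinite, but it is definable, so its own boundary is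
        finite.\<close>
      note tame = definable_rel_tame[OF assms(1) E, of e']
      obtain j where j: "e ?v \<in> cell ?S j (e ?v \<in> bd ?S)"
        using in_cell[OF tame(1)] by blast
      \<comment> \<open>Without boundary points of \<open>?S\<close> in the interval, and with
        \<open>y\<close> outside \<open>E\<close>, no point of the interval is in \<open>E\<close>.
        Hence none is a boundary point of any section, and every section is constant there.\<close>
      have const: "R (upd x e') y \<longleftrightarrow> R (upd x e') z"
        if x: "x \<in> A" and yz: "y < z" "{y..z} \<inter> bd ?S = {}" "\<not> E e' y" for x y z
      proof -
        have "\<not> E e' w" if w: "w \<in> {y..z}" for w
        proof (cases "y = w")
          case False
          with w have "y < w" "{y..w} \<subseteq> {y..z}"
            by (simp_all add: less_le)
          moreover from this(2) have "{y..w} \<inter> bd ?S = {}"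
            using yz(2) by blast
          ultimately show ?thesis
            using tame(2) yz(3) unfolding constant_off_def by blast
        qed (use yz in simp)
        with x have "{y..z} \<inter> bd {z. R (upd x e') z} = {}"
          unfolding E_def by blast
        then show ?thesis
          using definable_rel_tame(2)[OF assms(1) Ra[of x], of e'] yz(1)
          unfolding constant_off_def by blast
      qed
      have same: "R (upd x e') z \<longleftrightarrow> R (upd x e') (e ?v)"
        if x: "x \<in> A" and z: "z \<in> cell ?S j (e ?v \<in> bd ?S)" for x z
      proof (cases z "e ?v" rule: linorder_cases)
        case less
        have disj: "{z..e ?v} \<inter> bd ?S = {}"
          by (rule cell_disjoint_bd[OF tame(1) z j less])
        \<comment> \<open>\<open>const\<close> asks for the lower endpoint to lie outside
          \<open>E\<close>, which here must be carried down from \<open>e ?v\<close> to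
          \<open>z\<close>.\<close>
        then have "\<not> E e' z"
          using False tame(2) less unfolding constant_off_def by blast
        with const[OF x less disj] show ?thesis .
      next
        case greater
        have "{e ?v..z} \<inter> bd ?S = {}"
          by (rule cell_disjoint_bd[OF tame(1) j z greater])
        with const[OF x greater _ False] show ?thesis by blast
      qed simp
      have "T \<in> traces A (Q1 j (e ?v \<in> bd ?S)) ?K e0"
      proof (rule in_traces)
        fix x assume x: "x \<in> A"
        have "upd a (upd x e') = upd a e'" if "a \<in> A" for a
          using len[OF that] len[OF x] by (simp add: upd_upd)
        then have "E (upd x e') = E e'"
          unfolding E_def by (simp cong: bex_cong)
        then have "Q1 j (e ?v \<in> bd ?S) (upd x e') \<longleftrightarrow>
            (\<exists>z. z \<in> cell ?S j (e ?v \<in> bd ?S) \<and> R (upd x e') z)"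
          unfolding Q1_def by (simp only:)
        then show "R (upd x e') (e ?v) \<longleftrightarrow> Q1 j (e ?v \<in> bd ?S) (upd x e')"
          using j same[OF x] by blast
      qed
      then show ?thesis by blast
    qed
  qed
  then have "|traces A P {n..<n + Suc m} e0| \<le>o |?U1 \<union> ?U2|"
    by (rule card_of_mono1)
  moreover have "|?U1 \<union> ?U2| \<le>o |A|"
  proof -
    \<comment> \<open>The index sets of both unions, and by induction their members, have size at
      most \<open>|A|\<close>, which infinite cardinal arithmetic absorbs.\<close>
    have nat: "|UNIV :: nat set| \<le>o |A|"
      using assms(3) infinite_iff_card_of_nat by blast
    have bool: "|UNIV :: bool set| \<le>o |A|"
      using assms(3) card_of_finite_ordLeq_infinite finite by blast
    have "|?U1| \<le>o |A|"
      using Suc.IH[OF Q1] by (intro card_of_UNION_ordLeq_infinite[OF assms(3)] nat bool ballI)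
    moreover have "|?U2| \<le>o |A|"
      using Suc.IH[OF Q2]
      by (intro card_of_UNION_ordLeq_infinite[OF assms(3)] nat card_of_mono1 subset_refl ballI)
    ultimately show ?thesis
      using assms(3) by (intro card_of_Un_ordLeq_infinite_Field) (simp_all add: Field_card_of card_of_card_order_on)
  qed
  ultimately show ?case
    by (rule ordLeq_transitive)
qed

section \<open>From the number of traces to the weight\<close>

theorem corollary2:
  fixes M :: "('f, 'r, 'm::unbounded_dense_linorder) struct"
    and n :: nat
    and X :: "'m list topology"
  assumes "o_minimal M"
    and "definable_topological_space M n X"
    and "infinite (topspace X)"
  shows "weight X \<le>o |topspace X|"
proof -
  let ?A = "topspace X"
  obtain q l c where q: "is_formula M n l q" "length c = l" "?A = {a. length a = n \<and> holds M q a c}"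
    using assms(2) unfolding definable_topological_space_def definable_def by blast
  obtain p m B where p: "is_formula M n m p" and B: "definable M m B"
    and basis: "topology_basis X {{a \<in> ?A. holds M p a b} |b. b \<in> B}"
    using assms(2) unfolding definable_topological_space_def by blast
  have A: "?A \<subseteq> {a. length a = n}"
    using q(3) by blast
  have len_B: "length b = m" if "b \<in> B" for b
    using B that unfolding definable_def by blast
  have "definable_pred M (\<lambda>e. sat M (upd (map e [0..<n]) (\<lambda>i. c ! (i - n))) q)"
    using q(1) unfolding is_formula_def by (intro definable_pred_sat coord_upd_map) simp_all
  moreover have "map e [0..<n] \<in> ?A \<longleftrightarrow> sat M (upd (map e [0..<n]) (\<lambda>i. c ! (i - n))) q" for e
  proof -
    \<comment> \<open>The two sides agree at every index, even past the end of \<open>c\<close>,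
      since both then read \<open>c ! (i - n)\<close>.\<close>
    have "(!) (map e [0..<n] @ c) = upd (map e [0..<n]) (\<lambda>i. c ! (i - n))"
      by (auto simp: upd_def nth_append)
    then show ?thesis
      unfolding q(3) holds_def by simp
  qed
  ultimately have def_A: "definable_pred M (\<lambda>e. map e [0..<n] \<in> ?A)"
    by (simp only:)
  have def_p: "definable_pred M (\<lambda>e. sat M e p)"
    using p unfolding is_formula_def by (intro definable_pred_sat) simp_all
  \<comment> \<open>Any value will do: positions below \<open>n\<close> are overwritten by the
    tuple, and those from \<open>n + m\<close> on are not free in \<open>p\<close>.\<close>
  define e0 :: "nat \<Rightarrow> 'm" where "e0 = undefined"
  have "{a \<in> ?A. holds M p a b} \<in> traces ?A (\<lambda>e. sat M e p) {n..<n + m} e0" if b: "b \<in> B" for b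
  proof -
    define e where "e i = (if i \<in> {n..<n + m} then b ! (i - n) else e0 i)" for i
    have "holds M p a b \<longleftrightarrow> sat M (upd a e) p" if "a \<in> ?A" for a
    proof -
      have "length a = n" using A that by blast
      then have "(a @ b) ! i = upd a e i" if "i < n + m" for i
        using that by (simp add: nth_append upd_def e_def)
      then show ?thesis
        using p unfolding holds_def is_formula_def by (intro sat_cong) auto
    qed
    then have "{a \<in> ?A. holds M p a b} = {a \<in> ?A. sat M (upd a e) p}"
      by blast
    moreover have "\<forall>i. i \<notin> {n..<n + m} \<longrightarrow> e i = e0 i"
      unfolding e_def by simp
    ultimately show ?thesis
      unfolding traces_def by blast
  qed
  \<comment> \<open>The given definable basis thus consists of traces of \<open>p\<close>, and the
    weight is at most the size of any basis.\<close>
  then have "{{a \<in> ?A. holds M p a b} |b. b \<in> B} \<subseteq> traces ?A (\<lambda>e. sat M e p) {n..<n + m} e0"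
    by blast
  then have "|{{a \<in> ?A. holds M p a b} |b. b \<in> B}| \<le>o |traces ?A (\<lambda>e. sat M e p) {n..<n + m} e0|"
    by (rule card_of_mono1)
  moreover have "|traces ?A (\<lambda>e. sat M e p) {n..<n + m} e0| \<le>o |?A|"
    by (rule card_of_traces[OF assms(1) A assms(3) def_A def_p])
  ultimately show ?thesis
    using weight_le[OF basis] ordLeq_transitive by blast
qed

end
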